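(* Let $(\phi,\mathbf{B})$ be a QCSP instance. An empty judgement on $(\phi,\mathbf{B})$ is derivable if and only if $\mathbf{B}\not\models\phi$.
   Context: Multi-sorted relational first-order logic: a signature is a pair $(\sigma,\mathcal{S})$ of a set $\mathcal{S}$ of sorts and a set $\sigma$ of relation symbols, each $R\in\sigma$ having an arity $\mathrm{ar}(R)\in\mathcal{S}^*$. Each variable $v$ has a sort $s(v)$; an atom is $R(v_1,\dots,v_k)$ with $s(v_1)\cdots s(v_k)=\mathrm{ar}(R)$. A structure $\mathbf{B}$ consists of sets $B_s$ ($s\in\mathcal{S}$) and relations $R^{\mathbf{B}}\subseteq B_{w_1}\times\cdots\times B_{w_k}$ where $\mathrm{ar}(R)=w_1\cdots w_k$. A "map $f:V\to B$" on a set $V$ of variables satisfies $f(v)\in B_{s(v)}$. $f\upharpoonright S$ is restriction; $f[s\to b]$ is the extension mapping $s$ to $b$. A qc-formula is built from atoms, conjunction (arbitrary finite arity), $\forall$ and $\exists$; $\mathrm{free}(\phi)$ denotes its free variables; a qc-sentence has none. A QCSP instance is a pair $(\phi,\mathbf{B})$ of a qc-sentence and a structure over the same signature. Viewing $\phi$ as a tree, $I_\phi$ contains one index (location) per subformula occurrence; $\phi(i)$ is the subformula at $i$; parent/child refer to the tree. A constraint is $(V,F)$ with $V$ a set of variables occurring in $\phi$ and $F$ a set of maps $V\to B$ (exactly one map $\emptyset\to B$ exists). A judgement is $(i,V,F)$ with $i\in I_\phi$, $(V,F)$ a constraint, $V\subseteq\mathrm{free}(\phi(i))$; it is empty if $F=\emptyset$.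 $F_1\Join F_2=\{f:U_1\cup U_2\to B: f\upharpoonright U_1\in F_1, f\upharpoonright U_2\in F_2\}$ for constraints $(U_1,F_1),(U_2,F_2)$; for $y\in U$, $\epsilon_yF=\{f:U\setminus\{y\}\to B: f[y\to b]\in F \text{ for all } b\in B_{s(y)}\}$. A judgement proof is a finite sequence of judgements each of one of the types: (atom) $(i,\{v_1,\dots,v_k\},F)$ where $\phi(i)=R(v_1,\dots,v_k)$ and $F=\{f:(f(v_1),\dots,f(v_k))\in R^{\mathbf{B}}\}$; (projection) $(i,U,F\upharpoonright U)$ from a previous $(i,V,F)$ with $U\subseteq V$; (join) $(i,U_1\cup U_2,F_1\Join F_2)$ from previous $(i,U_1,F_1),(i,U_2,F_2)$; (upward flow) $(i,V,F)$ from previous $(j,V,F)$ with $i$ the parent of $j$; ($\forall$-elimination) $(i,V\setminus\{y\},\epsilon_yF)$ from previous $(j,V,F)$ with $y\in V$, $\phi(i)=\forall y\,\phi(j)$, $i$ the parent of $j$; (downward flow) $(j,V,F)$ from previous $(i,V,F)$ with $i$ the parent of $j$. A judgement is derivable if it occurs in some judgement proof.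
   Formalization: Every universe B_s is assumed nonempty (the usual convention for structures); with an empty B_s for the sort of x the claim fails, e.g. ∀x R(x) is true although its atom yields an empty judgement. *)

theory Defs
  imports Main "HOL-Library.FuncSet"
begin

record ('s, 'r) signature =
  sorts :: "'s set"
  rels :: "'r set"
  arity :: "'r \<Rightarrow> 's list"

definition wf_signature :: "('s, 'r) signature \<Rightarrow> bool" where
  "wf_signature \<Sigma> \<longleftrightarrow> (\<forall>R \<in> rels \<Sigma>. set (arity \<Sigma> R) \<subseteq> sorts \<Sigma>)"

text \<open>
  The universes of all sorts live in one type \<^typ>\<open>'b\<close>; they may overlap and may be infinite.
\<close>

record ('s, 'r, 'b) struct =
  universe :: "'s \<Rightarrow> 'b set"
  interp :: "'r \<Rightarrow> 'b list set"

text \<open>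
  Universes are nonempty, following the usual convention of first-order logic. With an empty
  universe for the sort of \<open>x\<close>, the sentence \<open>\<forall>x. R(x)\<close> is true, yet its atom already
  yields an empty judgement.
\<close>

definition structure_over :: "('s, 'r) signature \<Rightarrow> ('s, 'r, 'b) struct \<Rightarrow> bool" where
  "structure_over \<Sigma> B \<longleftrightarrow>
     (\<forall>w \<in> sorts \<Sigma>. universe B w \<noteq> {}) \<and>
     (\<forall>R \<in> rels \<Sigma>. interp B R \<subseteq> listset (map (universe B) (arity \<Sigma> R)))"

datatype (qc_vars: 'v, qc_rels: 'r) qc =
    Atom 'r "'v list"
  | Conj "('v, 'r) qc list"
  | Forall 'v "('v, 'r) qc"
  | Exists 'v "('v, 'r) qc"

primrec qc_over :: "('s, 'r) signature \<Rightarrow> ('v \<Rightarrow> 's) \<Rightarrow> ('v, 'r) qc \<Rightarrow> bool" where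
  "qc_over \<Sigma> s (Atom R vs) \<longleftrightarrow> R \<in> rels \<Sigma> \<and> map s vs = arity \<Sigma> R"
| "qc_over \<Sigma> s (Conj \<psi>s) \<longleftrightarrow> list_all (\<lambda>b. b) (map (qc_over \<Sigma> s) \<psi>s)"
| "qc_over \<Sigma> s (Forall y \<psi>) \<longleftrightarrow> s y \<in> sorts \<Sigma> \<and> qc_over \<Sigma> s \<psi>"
| "qc_over \<Sigma> s (Exists y \<psi>) \<longleftrightarrow> s y \<in> sorts \<Sigma> \<and> qc_over \<Sigma> s \<psi>"

primrec free :: "('v, 'r) qc \<Rightarrow> 'v set" where
  "free (Atom R vs) = set vs"
| "free (Conj \<psi>s) = \<Union> (set (map free \<psi>s))"
| "free (Forall y \<psi>) = free \<psi> - {y}"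
| "free (Exists y \<psi>) = free \<psi> - {y}"

primrec sat :: "('v \<Rightarrow> 's) \<Rightarrow> ('s, 'r, 'b) struct \<Rightarrow> ('v, 'r) qc \<Rightarrow> ('v \<Rightarrow> 'b) \<Rightarrow> bool" where
  "sat s B (Atom R vs) f \<longleftrightarrow> map f vs \<in> interp B R"
| "sat s B (Conj \<psi>s) f \<longleftrightarrow> list_all (\<lambda>p. p f) (map (sat s B) \<psi>s)"
| "sat s B (Forall y \<psi>) f \<longleftrightarrow> (\<forall>b \<in> universe B (s y). sat s B \<psi> (f(y := b)))"
| "sat s B (Exists y \<psi>) f \<longleftrightarrow> (\<exists>b \<in> universe B (s y). sat s B \<psi> (f(y := b)))"

text \<open>
  Intended for sentences only: \<^term>\<open>\<lambda>_. undefined\<close> is the unique map with empty domain.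
\<close>

definition models :: "('v \<Rightarrow> 's) \<Rightarrow> ('s, 'r, 'b) struct \<Rightarrow> ('v, 'r) qc \<Rightarrow> bool" where
  "models s B \<phi> \<longleftrightarrow> sat s B \<phi> (\<lambda>_. undefined)"

definition qcsp_instance ::
  "('s, 'r) signature \<Rightarrow> ('v \<Rightarrow> 's) \<Rightarrow> ('v, 'r) qc \<Rightarrow> ('s, 'r, 'b) struct \<Rightarrow> bool" where
  "qcsp_instance \<Sigma> s \<phi> B \<longleftrightarrow>
     wf_signature \<Sigma> \<and> qc_over \<Sigma> s \<phi> \<and> free \<phi> = {} \<and> structure_over \<Sigma> B"

text \<open>
  A location is the path from the root to a subformula occurrence, as the list of child positions.
\<close>

type_synonym loc = "nat list"

primrec children :: "('v, 'r) qc \<Rightarrow> ('v, 'r) qc list" where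
  "children (Atom R vs) = []"
| "children (Conj \<psi>s) = \<psi>s"
| "children (Forall y \<psi>) = [\<psi>]"
| "children (Exists y \<psi>) = [\<psi>]"

fun is_loc :: "('v, 'r) qc \<Rightarrow> loc \<Rightarrow> bool" where
  "is_loc \<phi> [] \<longleftrightarrow> True"
| "is_loc \<phi> (n # i) \<longleftrightarrow> n < length (children \<phi>) \<and> is_loc (children \<phi> ! n) i"

definition locs :: "('v, 'r) qc \<Rightarrow> loc set" where
  "locs \<phi> = {i. is_loc \<phi> i}"

text \<open>Only meaningful for \<open>i \<in> locs \<phi>\<close>.\<close>

fun subformula :: "('v, 'r) qc \<Rightarrow> loc \<Rightarrow> ('v, 'r) qc" where
  "subformula \<phi> [] = \<phi>"
| "subformula \<phi> (n # i) = subformula (children \<phi> ! n) i"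

definition is_parent :: "('v, 'r) qc \<Rightarrow> loc \<Rightarrow> loc \<Rightarrow> bool" where
  "is_parent \<phi> i j \<longleftrightarrow> i \<in> locs \<phi> \<and> j \<in> locs \<phi> \<and> (\<exists>n. j = i @ [n])"

text \<open>
  Maps on a set of variables are extensional functions, so restriction is \<^const>\<open>restrict\<close> and
  the extension of a map by \<open>y \<mapsto> b\<close> is function update.
\<close>

definition maps :: "('v \<Rightarrow> 's) \<Rightarrow> ('s, 'r, 'b) struct \<Rightarrow> 'v set \<Rightarrow> ('v \<Rightarrow> 'b) set" where
  "maps s B V = (\<Pi>\<^sub>E v \<in> V. universe B (s v))"

definition is_constraint ::
  "('v \<Rightarrow> 's) \<Rightarrow> ('s, 'r, 'b) struct \<Rightarrow> ('v, 'r) qc \<Rightarrow> 'v set \<Rightarrow> ('v \<Rightarrow> 'b) set \<Rightarrow> bool" where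
  "is_constraint s B \<phi> V F \<longleftrightarrow> V \<subseteq> qc_vars \<phi> \<and> F \<subseteq> maps s B V"

type_synonym ('v, 'b) judgement = "loc \<times> 'v set \<times> ('v \<Rightarrow> 'b) set"

definition is_judgement ::
  "('v \<Rightarrow> 's) \<Rightarrow> ('s, 'r, 'b) struct \<Rightarrow> ('v, 'r) qc \<Rightarrow> ('v, 'b) judgement \<Rightarrow> bool" where
  "is_judgement s B \<phi> = (\<lambda>(i, V, F).
     i \<in> locs \<phi> \<and> is_constraint s B \<phi> V F \<and> V \<subseteq> free (subformula \<phi> i))"

definition empty_judgement :: "('v, 'b) judgement \<Rightarrow> bool" where
  "empty_judgement = (\<lambda>(i, V, F). F = {})"

definition proj :: "'v set \<Rightarrow> ('v \<Rightarrow> 'b) set \<Rightarrow> ('v \<Rightarrow> 'b) set" where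
  "proj U F = (\<lambda>f. restrict f U) ` F"

definition join ::
  "('v \<Rightarrow> 's) \<Rightarrow> ('s, 'r, 'b) struct \<Rightarrow>
   'v set \<Rightarrow> ('v \<Rightarrow> 'b) set \<Rightarrow> 'v set \<Rightarrow> ('v \<Rightarrow> 'b) set \<Rightarrow> ('v \<Rightarrow> 'b) set" where
  "join s B U\<^sub>1 F\<^sub>1 U\<^sub>2 F\<^sub>2 =
     {f \<in> maps s B (U\<^sub>1 \<union> U\<^sub>2). restrict f U\<^sub>1 \<in> F\<^sub>1 \<and> restrict f U\<^sub>2 \<in> F\<^sub>2}"

definition forall_elim ::
  "('v \<Rightarrow> 's) \<Rightarrow> ('s, 'r, 'b) struct \<Rightarrow> 'v \<Rightarrow> 'v set \<Rightarrow> ('v \<Rightarrow> 'b) set \<Rightarrow> ('v \<Rightarrow> 'b) set" where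
  "forall_elim s B y U F =
     {f \<in> maps s B (U - {y}). \<forall>b \<in> universe B (s y). f(y := b) \<in> F}"

text \<open>
  \<open>inference s B \<phi> P J\<close>: the triple \<open>J\<close> results from one rule whose premises lie in \<open>P\<close>. That
  \<open>J\<close> is again a judgement is not automatic for the two flow rules (the variables must be
  free at the new location); \<open>judgement_proof\<close> requires it of every member.
\<close>

inductive inference ::
  "('v \<Rightarrow> 's) \<Rightarrow> ('s, 'r, 'b) struct \<Rightarrow> ('v, 'r) qc \<Rightarrow> ('v, 'b) judgement set \<Rightarrow>
   ('v, 'b) judgement \<Rightarrow> bool"
  for s B \<phi> P where
  atom:
    "i \<in> locs \<phi> \<Longrightarrow> subformula \<phi> i = Atom R vs \<Longrightarrow>
     inference s B \<phi> P (i, set vs, {f \<in> maps s B (set vs). map f vs \<in> interp B R})"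
| projection:
    "(i, V, F) \<in> P \<Longrightarrow> U \<subseteq> V \<Longrightarrow> inference s B \<phi> P (i, U, proj U F)"
| join:
    "(i, U\<^sub>1, F\<^sub>1) \<in> P \<Longrightarrow> (i, U\<^sub>2, F\<^sub>2) \<in> P \<Longrightarrow>
     inference s B \<phi> P (i, U\<^sub>1 \<union> U\<^sub>2, join s B U\<^sub>1 F\<^sub>1 U\<^sub>2 F\<^sub>2)"
| upward_flow:
    "(j, V, F) \<in> P \<Longrightarrow> is_parent \<phi> i j \<Longrightarrow> inference s B \<phi> P (i, V, F)"
| forall_elimination:
    "(j, V, F) \<in> P \<Longrightarrow> y \<in> V \<Longrightarrow> is_parent \<phi> i j \<Longrightarrow>
     subformula \<phi> i = Forall y (subformula \<phi> j) \<Longrightarrow>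
     inference s B \<phi> P (i, V - {y}, forall_elim s B y V F)"
| downward_flow:
    "(i, V, F) \<in> P \<Longrightarrow> is_parent \<phi> i j \<Longrightarrow> inference s B \<phi> P (j, V, F)"

definition judgement_proof ::
  "('v \<Rightarrow> 's) \<Rightarrow> ('s, 'r, 'b) struct \<Rightarrow> ('v, 'r) qc \<Rightarrow> ('v, 'b) judgement list \<Rightarrow> bool" where
  "judgement_proof s B \<phi> Js \<longleftrightarrow>
     (\<forall>k < length Js. is_judgement s B \<phi> (Js ! k) \<and> inference s B \<phi> (set (take k Js)) (Js ! k))"

definition derivable ::
  "('v \<Rightarrow> 's) \<Rightarrow> ('s, 'r, 'b) struct \<Rightarrow> ('v, 'r) qc \<Rightarrow> ('v, 'b) judgement \<Rightarrow> bool" where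
  "derivable s B \<phi> J \<longleftrightarrow> (\<exists>Js. judgement_proof s B \<phi> Js \<and> J \<in> set Js)"

end

theory Submission
  imports Defs
begin

text \<open>
  Soundness: if the sentence is true, consider the positions of the model-checking game that are
  reached when the universal player moves arbitrarily and the existential player only moves to
  satisfying assignments. Every derivable judgement \<open>(i, V, F)\<close> holds at every position reached
  at \<open>i\<close>, in the sense that the restriction of the assignment to \<open>V\<close> lies in \<open>F\<close>; and some
  position is reached at each location, so \<open>F\<close> is nonempty. Completeness: going from the leaves
  to the root, the judgement whose maps are exactly the satisfying assignments of the subformula is
  derivable at every location, except where no atom occurs; there the subformula is a valid sentence.
\<close>

section \<open>Paths in the formula tree, and dependence of truth on free variables\<close>

section \<open>Locations\<close>

text \<open>The recursion on paths peels off the step nearest the root, whereas passing from parent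
  to child appends a step at the far end; this lemma and \<open>subformula_snoc\<close> translate
  between the two.\<close>

lemma is_loc_snoc:
  "is_loc \<phi> (i @ [n]) \<longleftrightarrow> is_loc \<phi> i \<and> n < length (children (subformula \<phi> i))"
  by (induction \<phi> i rule: is_loc.induct) auto

lemma subformula_snoc: "subformula \<phi> (i @ [n]) = children (subformula \<phi> i) ! n"
  by (induction \<phi> i rule: subformula.induct) auto

lemma is_parent_iff:
  "is_parent \<phi> i j \<longleftrightarrow> i \<in> locs \<phi> \<and> (\<exists>n < length (children (subformula \<phi> i)). j = i @ [n])"
  by (auto simp: is_parent_def locs_def is_loc_snoc)

lemma is_parent_snoc:
  "is_parent \<phi> i (i @ [n]) \<longleftrightarrow> i \<in> locs \<phi> \<and> n < length (children (subformula \<phi> i))"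
  by (auto simp: is_parent_iff)

lemma locs_snoc:
  "i @ [n] \<in> locs \<phi> \<longleftrightarrow> i \<in> locs \<phi> \<and> n < length (children (subformula \<phi> i))"
  by (simp add: locs_def is_loc_snoc)

lemma qc_over_subformula:
  "\<lbrakk>qc_over \<Sigma> s \<phi>; is_loc \<phi> i\<rbrakk> \<Longrightarrow> qc_over \<Sigma> s (subformula \<phi> i)"
proof (induction \<phi> i rule: is_loc.induct)
  case (2 \<phi> n i)
  then show ?case by (cases \<phi>) (auto simp: list_all_iff)
qed simp

lemma qc_vars_subformula: "is_loc \<phi> i \<Longrightarrow> qc_vars (subformula \<phi> i) \<subseteq> qc_vars \<phi>"
proof (induction \<phi> i rule: is_loc.induct)
  case (2 \<phi> n i)
  have "qc_vars (children \<phi> ! n) \<subseteq> qc_vars \<phi>"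
    using 2(2) by (cases \<phi>) (auto dest: nth_mem)
  with 2 show ?case by auto
qed simp

lemma free_subset_qc_vars: "free \<phi> \<subseteq> qc_vars \<phi>"
  by (induction \<phi>) auto

text \<open>The coincidence lemma. Assignments in \<open>sat\<close> are total, so this is what
  allows restricting them or changing them at a variable that is not free.\<close>

lemma sat_cong: "(\<And>v. v \<in> free \<phi> \<Longrightarrow> f v = g v) \<Longrightarrow> sat s B \<phi> f \<longleftrightarrow> sat s B \<phi> g"
proof (induction \<phi> arbitrary: f g)
  case (Atom R vs)
  then have "map f vs = map g vs" by simp
  then show ?case by (simp only: sat.simps)
next
  case (Conj \<psi>s)
  have "sat s B \<psi> f \<longleftrightarrow> sat s B \<psi> g" if "\<psi> \<in> set \<psi>s" for \<psi>
    using that by (intro Conj.IH Conj.prems) auto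
  then show ?case by (simp add: list_all_iff)
next
  case (Forall y \<psi>)
  then have "sat s B \<psi> (f(y := b)) \<longleftrightarrow> sat s B \<psi> (g(y := b))" for b
    by (intro Forall.IH) auto
  then show ?case by simp
next
  case (Exists y \<psi>)
  then have "sat s B \<psi> (f(y := b)) \<longleftrightarrow> sat s B \<psi> (g(y := b))" for b
    by (intro Exists.IH) auto
  then show ?case by simp
qed

section \<open>Concatenation of proofs, closure under the rules, and rule induction\<close>

section \<open>Derivability\<close>

lemma inference_mono:
  assumes "inference s B \<phi> P J" "P \<subseteq> Q"
  shows "inference s B \<phi> Q J"
  using assms by (cases rule: inference.cases) (auto intro: inference.intros)

text \<open>Concatenation only enlarges the stock of earlier judgements for the second proof, and
  inference is monotone in that stock.\<close>

lemma judgement_proof_append: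
  assumes "judgement_proof s B \<phi> Js" "judgement_proof s B \<phi> Ks"
  shows "judgement_proof s B \<phi> (Js @ Ks)"
  unfolding judgement_proof_def
proof (intro allI impI)
  fix k assume k: "k < length (Js @ Ks)"
  show "is_judgement s B \<phi> ((Js @ Ks) ! k) \<and>
    inference s B \<phi> (set (take k (Js @ Ks))) ((Js @ Ks) ! k)"
  proof (cases "k < length Js")
    case True
    with assms(1) show ?thesis by (simp add: judgement_proof_def nth_append)
  next
    case False
    then have "is_judgement s B \<phi> (Ks ! (k - length Js))"
      and "inference s B \<phi> (set (take (k - length Js) Ks)) (Ks ! (k - length Js))"
      using k assms(2) by (auto simp: judgement_proof_def)
    with False show ?thesis by (auto simp: nth_append elim: inference_mono)
  qed
qed

lemma judgement_proof_snoc: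
  assumes "judgement_proof s B \<phi> Js" "is_judgement s B \<phi> J" "inference s B \<phi> (set Js) J"
  shows "judgement_proof s B \<phi> (Js @ [J])"
  using assms by (auto simp: judgement_proof_def nth_append less_Suc_eq)

text \<open>Proofs of the finitely many premises are concatenated and the conclusion is appended, so
  derivability can be handled rule by rule without mentioning sequences.\<close>

lemma derivable_inference:
  assumes "finite P" "\<And>K. K \<in> P \<Longrightarrow> derivable s B \<phi> K"
    and "inference s B \<phi> P J" "is_judgement s B \<phi> J"
  shows "derivable s B \<phi> J"
proof -
  have "\<exists>Js. judgement_proof s B \<phi> Js \<and> P \<subseteq> set Js"
    using assms(1,2)
  proof (induction P)
    case empty
    have "judgement_proof s B \<phi> []" by (simp add: judgement_proof_def)
    then show ?case by blast
  next
    case (insert K P)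
    then obtain Js where "judgement_proof s B \<phi> Js" "P \<subseteq> set Js" by auto
    moreover obtain Ks where "judgement_proof s B \<phi> Ks" "K \<in> set Ks"
      using insert.prems unfolding derivable_def by blast
    ultimately show ?case
      by (intro exI[of _ "Js @ Ks"]) (auto intro: judgement_proof_append)
  qed
  then obtain Js where Js: "judgement_proof s B \<phi> Js" "P \<subseteq> set Js" by blast
  have "judgement_proof s B \<phi> (Js @ [J])"
    using Js assms(3,4) by (intro judgement_proof_snoc) (auto intro: inference_mono)
  then show ?thesis unfolding derivable_def by (intro exI[of _ "Js @ [J]"]) simp
qed

lemma derivable_projection:
  assumes "derivable s B \<phi> (i, V, F)" "U \<subseteq> V" "is_judgement s B \<phi> (i, U, proj U F)"
  shows "derivable s B \<phi> (i, U, proj U F)"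
  using assms inference.projection[OF singletonI assms(2)] derivable_inference[of "{(i, V, F)}"]
  by blast

lemma derivable_join:
  assumes "derivable s B \<phi> (i, U\<^sub>1, F\<^sub>1)" "derivable s B \<phi> (i, U\<^sub>2, F\<^sub>2)"
    and "is_judgement s B \<phi> (i, U\<^sub>1 \<union> U\<^sub>2, join s B U\<^sub>1 F\<^sub>1 U\<^sub>2 F\<^sub>2)"
  shows "derivable s B \<phi> (i, U\<^sub>1 \<union> U\<^sub>2, join s B U\<^sub>1 F\<^sub>1 U\<^sub>2 F\<^sub>2)"
proof (rule derivable_inference[of "{(i, U\<^sub>1, F\<^sub>1), (i, U\<^sub>2, F\<^sub>2)}"])
  show "inference s B \<phi> {(i, U\<^sub>1, F\<^sub>1), (i, U\<^sub>2, F\<^sub>2)} (i, U\<^sub>1 \<union> U\<^sub>2, join s B U\<^sub>1 F\<^sub>1 U\<^sub>2 F\<^sub>2)"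
    by (rule inference.join) simp_all
qed (use assms in blast)+

lemma derivable_upward_flow:
  assumes "derivable s B \<phi> (j, V, F)" "is_parent \<phi> i j" "is_judgement s B \<phi> (i, V, F)"
  shows "derivable s B \<phi> (i, V, F)"
  using assms inference.upward_flow[OF singletonI assms(2)] derivable_inference[of "{(j, V, F)}"]
  by blast

lemma derivable_forall_elimination:
  assumes "derivable s B \<phi> (j, V, F)" "y \<in> V" "is_parent \<phi> i j"
    and "subformula \<phi> i = Forall y (subformula \<phi> j)"
    and "is_judgement s B \<phi> (i, V - {y}, forall_elim s B y V F)"
  shows "derivable s B \<phi> (i, V - {y}, forall_elim s B y V F)"
  using assms inference.forall_elimination[OF singletonI assms(2-4)]
    derivable_inference[of "{(j, V, F)}"]
  by blast

text \<open>Strong induction on the position in a proof. That the premises are judgements is kept as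
  a hypothesis because downward flow needs the variable bound at the premise's location.\<close>

lemma derivable_induct [consumes 1, case_names inference]:
  assumes "derivable s B \<phi> J"
    and step: "\<And>P J. \<lbrakk>\<And>K. K \<in> P \<Longrightarrow> is_judgement s B \<phi> K; \<And>K. K \<in> P \<Longrightarrow> Q K;
      is_judgement s B \<phi> J; inference s B \<phi> P J\<rbrakk> \<Longrightarrow> Q J"
  shows "Q J"
proof -
  obtain Js where Js: "judgement_proof s B \<phi> Js" "J \<in> set Js"
    using assms(1) unfolding derivable_def by blast
  have "Q (Js ! k)" if "k < length Js" for k
    using that
  proof (induction k rule: less_induct)
    case (less k)
    show ?case
    proof (rule step)
      show "is_judgement s B \<phi> (Js ! k)" "inference s B \<phi> (set (take k Js)) (Js ! k)"
        using Js less.prems by (auto simp: judgement_proof_def)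
      fix K assume "K \<in> set (take k Js)"
      then obtain l where "l < k" "K = Js ! l"
        using less.prems by (auto simp: in_set_conv_nth)
      then show "is_judgement s B \<phi> K" "Q K"
        using Js less by (auto simp: judgement_proof_def)
    qed
  qed
  with Js(2) show ?thesis by (auto simp: in_set_conv_nth)
qed

section \<open>Positions of the model-checking game as an invariant of derivations\<close>

section \<open>Soundness\<close>

text \<open>Assignments are total and start out undefined everywhere; a quantifier move overwrites
  one value. Only \<open>exists\<close> carries a truth condition, since for the other moves truth
  passes from parent to child.\<close>

inductive reached ::
  "('v \<Rightarrow> 's) \<Rightarrow> ('s, 'r, 'b) struct \<Rightarrow> ('v, 'r) qc \<Rightarrow> loc \<Rightarrow> ('v \<Rightarrow> 'b) \<Rightarrow> bool"
  for s B \<phi> where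
  root: "reached s B \<phi> [] (\<lambda>_. undefined)"
| conj: "reached s B \<phi> i f \<Longrightarrow> subformula \<phi> i = Conj \<psi>s \<Longrightarrow> n < length \<psi>s \<Longrightarrow>
    reached s B \<phi> (i @ [n]) f"
| forall: "reached s B \<phi> i f \<Longrightarrow> subformula \<phi> i = Forall y \<psi> \<Longrightarrow> b \<in> universe B (s y) \<Longrightarrow>
    reached s B \<phi> (i @ [0]) (f(y := b))"
| exists: "reached s B \<phi> i f \<Longrightarrow> subformula \<phi> i = Exists y \<psi> \<Longrightarrow> b \<in> universe B (s y) \<Longrightarrow>
    sat s B \<psi> (f(y := b)) \<Longrightarrow> reached s B \<phi> (i @ [0]) (f(y := b))"

lemma reached_sat:
  assumes "reached s B \<phi> i f" "models s B \<phi>"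
  shows "sat s B (subformula \<phi> i) f"
  using assms
  by induction (auto simp: models_def subformula_snoc list_all_iff)

text \<open>Nothing is free at the root of a sentence, and a variable becomes free on the way down
  only by a quantifier move, which draws its value from the right universe.\<close>

lemma reached_universe:
  assumes "reached s B \<phi> i f" "free \<phi> = {}"
  shows "\<forall>v \<in> free (subformula \<phi> i). f v \<in> universe B (s v)"
  using assms by induction (auto simp: subformula_snoc)

text \<open>A play can continue to any child: truth at the current position supplies the existential
  move, nonemptiness of the universe the universal one. Only the bound variable changes, and it is
  not free at the parent.\<close>

lemma reached_child:
  assumes "reached s B \<phi> i f" "is_parent \<phi> i j" "models s B \<phi>"
    and "qc_over \<Sigma> s \<phi>" "structure_over \<Sigma> B"
  shows "\<exists>g. reached s B \<phi> j g \<and> (\<forall>v \<in> free (subformula \<phi> i). g v = f v)"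
proof -
  obtain n where n: "n < length (children (subformula \<phi> i))" "j = i @ [n]" and i: "is_loc \<phi> i"
    using assms(2) by (auto simp: is_parent_iff locs_def)
  have sat: "sat s B (subformula \<phi> i) f" using reached_sat assms(1,3) by blast
  have over: "qc_over \<Sigma> s (subformula \<phi> i)" using qc_over_subformula[OF assms(4) i] .
  show ?thesis
  proof (cases "subformula \<phi> i")
    case (Atom R vs)
    with n show ?thesis by simp
  next
    case (Conj \<psi>s)
    then show ?thesis using n reached.conj[OF assms(1) Conj, of n] by auto
  next
    case (Forall y \<psi>)
    then obtain b where "b \<in> universe B (s y)"
      using over assms(5) by (force simp: structure_over_def)
    from reached.forall[OF assms(1) Forall this] n Forall show ?thesis
      by (intro exI[of _ "f(y := b)"]) auto
  next
    case (Exists y \<psi>)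
    then obtain b where "b \<in> universe B (s y)" "sat s B \<psi> (f(y := b))"
      using sat by auto
    from reached.exists[OF assms(1) Exists this] n Exists show ?thesis
      by (intro exI[of _ "f(y := b)"]) auto
  qed
qed

text \<open>The last move is undone; it altered at most the variable bound at \<open>i\<close>.
  Downward flow relies on this as upward flow relies on \<open>reached_child\<close>.\<close>

lemma reached_parent:
  assumes "reached s B \<phi> (i @ [n]) g"
  shows "\<exists>f. reached s B \<phi> i f \<and> (\<forall>v \<in> free (subformula \<phi> i). f v = g v)"
  using assms by (cases rule: reached.cases) fastforce+

lemma reached_nonempty:
  assumes "i \<in> locs \<phi>" "models s B \<phi>" "qc_over \<Sigma> s \<phi>" "structure_over \<Sigma> B"
  shows "\<exists>f. reached s B \<phi> i f"
  using assms(1)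
proof (induction i rule: rev_induct)
  case Nil
  show ?case using reached.root by blast
next
  case (snoc n i)
  then obtain f where "reached s B \<phi> i f" by (auto simp: locs_snoc)
  moreover have "is_parent \<phi> i (i @ [n])" using snoc.prems by (simp add: locs_snoc is_parent_snoc)
  ultimately show ?case using reached_child assms(2-4) by blast
qed

text \<open>The invariant speaks of all positions at a location, not of one chosen play: universal
  elimination needs it at the child for every value of the eliminated variable.\<close>

lemma derivable_reached:
  fixes B :: "('s, 'r, 'b) struct"
  assumes "derivable s B \<phi> J" "models s B \<phi>" "qcsp_instance \<Sigma> s \<phi> B"
  shows "case J of (i, V, F) \<Rightarrow> \<forall>f. reached s B \<phi> i f \<longrightarrow> restrict f V \<in> F"
  using assms(1)
proof (induction rule: derivable_induct)
  case (inference P J)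
  have inst: "qc_over \<Sigma> s \<phi>" "structure_over \<Sigma> B" "free \<phi> = {}"
    using assms(3) by (auto simp: qcsp_instance_def)
  have IH: "restrict f V \<in> F" if "(i, V, F) \<in> P" "reached s B \<phi> i f" for i V F f
    using inference.IH[OF that(1)] that(2) by blast
  have restrict_maps: "restrict f V \<in> maps s B V"
    if "reached s B \<phi> i f" "V \<subseteq> free (subformula \<phi> i)" for i f V
    using reached_universe[OF that(1) inst(3)] that(2) by (auto simp: maps_def)
  have restrict_eq: "restrict f V = restrict g V"
    if "V \<subseteq> W" "\<forall>v \<in> W. f v = g v" for f g :: "'a \<Rightarrow> 'b" and V W
    using that by (auto simp: restrict_def fun_eq_iff)
  from inference.hyps(3) show ?case
  proof cases
    case (atom i R vs)
    have "restrict f (set vs) \<in> {f \<in> maps s B (set vs). map f vs \<in> interp B R}"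
      if "reached s B \<phi> i f" for f
    proof -
      have "map (restrict f (set vs)) vs = map f vs" by simp
      moreover have "map f vs \<in> interp B R"
        using reached_sat[OF that assms(2)] atom(3) by simp
      moreover have "restrict f (set vs) \<in> maps s B (set vs)"
        using restrict_maps[OF that] atom(3) by simp
      ultimately show ?thesis by (simp only: mem_Collect_eq)
    qed
    then show ?thesis unfolding atom(1) by blast
  next
    case (projection i V F U)
    have "restrict f U \<in> proj U F" if "reached s B \<phi> i f" for f
    proof -
      have "restrict f U = restrict (restrict f V) U"
        using projection(3) by (auto simp: restrict_def fun_eq_iff)
      then show ?thesis unfolding proj_def using IH[OF projection(2) that] by (rule image_eqI)
    qed
    then show ?thesis unfolding projection(1) by blast
  next
    case (join i U\<^sub>1 F\<^sub>1 U\<^sub>2 F\<^sub>2)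
    have "U\<^sub>1 \<union> U\<^sub>2 \<subseteq> free (subformula \<phi> i)"
      using inference.hyps(2) join(1) by (auto simp: is_judgement_def)
    then have "restrict f (U\<^sub>1 \<union> U\<^sub>2) \<in> Defs.join s B U\<^sub>1 F\<^sub>1 U\<^sub>2 F\<^sub>2" if "reached s B \<phi> i f" for f
      using IH[OF join(2) that] IH[OF join(3) that] restrict_maps[OF that]
      by (auto simp: join_def Int_absorb1)
    then show ?thesis unfolding join(1) by blast
  next
    case (upward_flow j V F i)
    \<comment> \<open>The bound at the parent comes from the conclusion being a judgement; it keeps
      the variable bound at \<open>i\<close> out of \<open>V\<close>, so the move to
      \<open>j\<close> does not affect the restriction.\<close>
    have V: "V \<subseteq> free (subformula \<phi> i)"
      using inference.hyps(2) upward_flow(1) by (auto simp: is_judgement_def)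
    have "restrict f V \<in> F" if f: "reached s B \<phi> i f" for f
    proof -
      obtain g where g: "reached s B \<phi> j g" "\<forall>v \<in> free (subformula \<phi> i). g v = f v"
        using reached_child[OF f upward_flow(3) assms(2) inst(1,2)] by blast
      from IH[OF upward_flow(2) g(1)] restrict_eq[OF V g(2)] show ?thesis by simp
    qed
    then show ?thesis unfolding upward_flow(1) by blast
  next
    case (forall_elimination j V F y i)
    have V: "V - {y} \<subseteq> free (subformula \<phi> i)"
      using inference.hyps(2) forall_elimination(1) by (auto simp: is_judgement_def)
    have j: "j = i @ [0]"
      using forall_elimination(4,5) by (auto simp: is_parent_iff)
    \<comment> \<open>Every \<open>b\<close> is a legal universal move from \<open>f\<close>, so
      \<open>f(y := b)\<close> is reached at \<open>j\<close> and the induction hypothesis applies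
      to it.\<close>
    have "(restrict f (V - {y}))(y := b) \<in> F"
      if "reached s B \<phi> i f" "b \<in> universe B (s y)" for f b
    proof -
      have "(restrict f (V - {y}))(y := b) = restrict (f(y := b)) V"
        using forall_elimination(3) by (auto simp: restrict_def fun_eq_iff)
      with IH[OF forall_elimination(2)] reached.forall[OF that(1) forall_elimination(5) that(2)] j
      show ?thesis by simp
    qed
    then show ?thesis
      unfolding forall_elimination(1) forall_elim_def using restrict_maps[OF _ V] by blast
  next
    case (downward_flow i V F j)
    \<comment> \<open>Here the parent is the location of the premise, so the bound comes from the
      premise.\<close>
    have V: "V \<subseteq> free (subformula \<phi> i)"
      using inference.hyps(1)[OF downward_flow(2)] by (auto simp: is_judgement_def)
    have "restrict g V \<in> F" if g: "reached s B \<phi> j g" for g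
    proof -
      obtain f where f: "reached s B \<phi> i f" "\<forall>v \<in> free (subformula \<phi> i). f v = g v"
        using reached_parent g downward_flow(3) by (fastforce simp: is_parent_iff)
      from IH[OF downward_flow(2) f(1)] restrict_eq[OF V f(2)] show ?thesis by simp
    qed
    then show ?thesis unfolding downward_flow(1) by blast
  qed
qed

section \<open>Relations defined by subformulas, derived from the leaves to the root\<close>

section \<open>Completeness\<close>

definition sat_maps ::
  "('v \<Rightarrow> 's) \<Rightarrow> ('s, 'r, 'b) struct \<Rightarrow> ('v, 'r) qc \<Rightarrow> ('v \<Rightarrow> 'b) set" where
  "sat_maps s B \<chi> = {f \<in> maps s B (free \<chi>). sat s B \<chi> f}"

lemma sat_maps_subset: "sat_maps s B \<chi> \<subseteq> maps s B (free \<chi>)"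
  by (auto simp: sat_maps_def)

lemma sat_restrict: "free \<chi> \<subseteq> V \<Longrightarrow> sat s B \<chi> (restrict f V) \<longleftrightarrow> sat s B \<chi> f"
  by (rule sat_cong) auto

lemma is_judgementI:
  assumes "i \<in> locs \<phi>" "V \<subseteq> free (subformula \<phi> i)" "F \<subseteq> maps s B V"
  shows "is_judgement s B \<phi> (i, V, F)"
  using assms qc_vars_subformula[of \<phi> i] free_subset_qc_vars[of "subformula \<phi> i"]
  by (auto simp: is_judgement_def is_constraint_def locs_def)

text \<open>Truth of each conjunct survives restriction to its own free variables. The formula
  \<open>\<chi>\<close> is any formula equivalent to the binary conjunction, so that a list
  conjunction extended by one conjunct fits.\<close>

lemma join_sat_maps:
  assumes "free \<chi> = free \<psi>\<^sub>1 \<union> free \<psi>\<^sub>2" "\<And>f. sat s B \<chi> f \<longleftrightarrow> sat s B \<psi>\<^sub>1 f \<and> sat s B \<psi>\<^sub>2 f"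
  shows "Defs.join s B (free \<psi>\<^sub>1) (sat_maps s B \<psi>\<^sub>1) (free \<psi>\<^sub>2) (sat_maps s B \<psi>\<^sub>2) = sat_maps s B \<chi>"
proof -
  have "restrict f U \<in> maps s B U" if "f \<in> maps s B V" "U \<subseteq> V" for f U V
    using that by (auto simp: maps_def)
  then have "restrict f (free \<psi>\<^sub>1) \<in> maps s B (free \<psi>\<^sub>1)"
    and "restrict f (free \<psi>\<^sub>2) \<in> maps s B (free \<psi>\<^sub>2)"
    if "f \<in> maps s B (free \<psi>\<^sub>1 \<union> free \<psi>\<^sub>2)" for f
    using that by blast+
  then show ?thesis
    unfolding join_def sat_maps_def assms mem_Collect_eq sat_restrict[OF order_refl] by blast
qed

text \<open>With \<open>y\<close> free in \<open>\<psi>\<close>, updating at \<open>y\<close> turns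
  a map on the remaining free variables into a map on exactly \<open>free \<psi>\<close>; otherwise
  the update could break extensionality.\<close>

lemma forall_elim_sat_maps:
  assumes "y \<in> free \<psi>"
  shows "forall_elim s B y (free \<psi>) (sat_maps s B \<psi>) = sat_maps s B (Forall y \<psi>)"
proof -
  have "f(y := b) \<in> maps s B (free \<psi>)"
    if "f \<in> maps s B (free \<psi> - {y})" "b \<in> universe B (s y)" for f b
    using that assms by (auto simp: maps_def PiE_iff extensional_def)
  then show ?thesis by (auto simp: forall_elim_def sat_maps_def)
qed

lemma proj_sat_maps:
  assumes "universe B (s y) \<noteq> {}"
  shows "proj (free \<psi> - {y}) (sat_maps s B \<psi>) = sat_maps s B (Exists y \<psi>)"
proof (intro equalityI subsetI)
  fix f assume "f \<in> proj (free \<psi> - {y}) (sat_maps s B \<psi>)"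
  then obtain g where g: "g \<in> maps s B (free \<psi>)" "sat s B \<psi> g" "f = restrict g (free \<psi> - {y})"
    by (auto simp: proj_def sat_maps_def)
  obtain c where c: "c \<in> universe B (s y)" using assms by blast
  \<comment> \<open>If \<open>y\<close> is not free in \<open>\<psi>\<close>, then
    \<open>g y\<close> is \<open>undefined\<close> and may lie outside the universe, so an arbitrary
    element serves as witness.\<close>
  define b where "b = (if y \<in> free \<psi> then g y else c)"
  have "b \<in> universe B (s y)" using g(1) c by (auto simp: b_def maps_def)
  moreover have "sat s B \<psi> (f(y := b)) \<longleftrightarrow> sat s B \<psi> g"
    by (rule sat_cong) (auto simp: g(3) b_def)
  ultimately show "f \<in> sat_maps s B (Exists y \<psi>)"
    using g by (auto simp: sat_maps_def maps_def)
next
  fix f assume "f \<in> sat_maps s B (Exists y \<psi>)"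
  then obtain b where f: "f \<in> maps s B (free \<psi> - {y})" "b \<in> universe B (s y)"
      "sat s B \<psi> (f(y := b))"
    by (auto simp: sat_maps_def)
  have "restrict (f(y := b)) (free \<psi>) \<in> maps s B (free \<psi>)"
    using f(1,2) by (simp add: maps_def PiE_iff)
  then have "restrict (f(y := b)) (free \<psi>) \<in> sat_maps s B \<psi>"
    using f(3) by (simp add: sat_maps_def sat_restrict)
  moreover have "f = restrict (restrict (f(y := b)) (free \<psi>)) (free \<psi> - {y})"
    using f(1) by (intro ext) (auto simp: maps_def PiE_iff extensional_def)
  ultimately show "f \<in> proj (free \<psi> - {y}) (sat_maps s B \<psi>)"
    unfolding proj_def by blast
qed

text \<open>The first alternative covers subformulas such as the empty conjunction, which offer no
  atom from which to start a derivation.\<close>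

lemma derivable_sat_maps:
  assumes "qc_over \<Sigma> s \<phi>" "structure_over \<Sigma> B"
  shows "\<lbrakk>i \<in> locs \<phi>; subformula \<phi> i = \<chi>\<rbrakk> \<Longrightarrow>
    free \<chi> = {} \<and> (\<forall>f. sat s B \<chi> f) \<or> derivable s B \<phi> (i, free \<chi>, sat_maps s B \<chi>)"
proof (induction \<chi> arbitrary: i)
  case (Atom R vs)
  have "inference s B \<phi> {} (i, free (Atom R vs), sat_maps s B (Atom R vs))"
    using inference.atom[of i \<phi> R vs s B "{}"] Atom by (simp add: sat_maps_def)
  moreover have "is_judgement s B \<phi> (i, free (Atom R vs), sat_maps s B (Atom R vs))"
    using Atom by (intro is_judgementI sat_maps_subset) auto
  ultimately show ?case by (blast intro: derivable_inference[of "{}"])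
next
  case (Conj \<psi>s)
  \<comment> \<open>The join rule is binary, so conjuncts are added one at a time. A proper prefix
    need not be a subformula of \<open>\<phi>\<close>; its judgement is placed at \<open>i\<close>
    all the same.\<close>
  let ?C = "\<lambda>m. Conj (take m \<psi>s)"
  have sub: "free (?C m) \<subseteq> free (subformula \<phi> i)" for m
    using Conj.prems by (auto dest: in_set_takeD)
  have "free (?C m) = {} \<and> (\<forall>f. sat s B (?C m) f) \<or>
      derivable s B \<phi> (i, free (?C m), sat_maps s B (?C m))" if "m \<le> length \<psi>s" for m
    using that
  proof (induction m)
    case 0
    have "sat s B (?C 0) f" for f by simp
    then show ?case by simp
  next
    case (Suc m)
    let ?\<psi> = "\<psi>s ! m"
    have m: "m < length \<psi>s" using Suc.prems by simp
    have fr: "free (?C (Suc m)) = free (?C m) \<union> free ?\<psi>"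
      using m by (auto simp: take_Suc_conv_app_nth)
    have st: "sat s B (?C (Suc m)) f \<longleftrightarrow> sat s B (?C m) f \<and> sat s B ?\<psi> f" for f
      using m by (auto simp: take_Suc_conv_app_nth)
    have parent: "is_parent \<phi> i (i @ [m])"
      using Conj.prems m by (simp add: is_parent_snoc)
    have "free ?\<psi> = {} \<and> (\<forall>f. sat s B ?\<psi> f) \<or>
        derivable s B \<phi> (i @ [m], free ?\<psi>, sat_maps s B ?\<psi>)"
      using Conj.prems m by (intro Conj.IH) (auto simp: locs_snoc subformula_snoc)
    then have child: "free ?\<psi> = {} \<and> (\<forall>f. sat s B ?\<psi> f) \<or>
        derivable s B \<phi> (i, free ?\<psi>, sat_maps s B ?\<psi>)"
    proof
      assume d: "derivable s B \<phi> (i @ [m], free ?\<psi>, sat_maps s B ?\<psi>)"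
      have "is_judgement s B \<phi> (i, free ?\<psi>, sat_maps s B ?\<psi>)"
        using Conj.prems(1) sub[of "Suc m"] unfolding fr by (intro is_judgementI sat_maps_subset) auto
      then have "derivable s B \<phi> (i, free ?\<psi>, sat_maps s B ?\<psi>)"
        by (rule derivable_upward_flow[OF d parent])
      then show ?thesis by blast
    qed blast
    have prev: "free (?C m) = {} \<and> (\<forall>f. sat s B (?C m) f) \<or>
        derivable s B \<phi> (i, free (?C m), sat_maps s B (?C m))"
      using Suc by simp
    show ?case
    \<comment> \<open>A valid sentence on either side changes neither free variables nor truth, so
      the judgement of the other side is reused; a join is made only when both sides are
      derivable.\<close>
    proof (cases "free ?\<psi> = {} \<and> (\<forall>f. sat s B ?\<psi> f)")
      case True
      then have "free (?C (Suc m)) = free (?C m)" "sat s B (?C (Suc m)) = sat s B (?C m)"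
        using fr st by auto
      then show ?thesis using prev unfolding sat_maps_def by simp
    next
      case nontriv: False
      show ?thesis
      proof (cases "free (?C m) = {} \<and> (\<forall>f. sat s B (?C m) f)")
        case True
        then have "free (?C (Suc m)) = free ?\<psi>" "sat s B (?C (Suc m)) = sat s B ?\<psi>"
          using fr st by auto
        then show ?thesis using child unfolding sat_maps_def by simp
      next
        case False
        then have "derivable s B \<phi> (i, free (?C m), sat_maps s B (?C m))"
          and "derivable s B \<phi> (i, free ?\<psi>, sat_maps s B ?\<psi>)"
          using nontriv child prev by blast+
        moreover have "is_judgement s B \<phi> (i, free (?C (Suc m)), sat_maps s B (?C (Suc m)))"
          using Conj.prems(1) sub by (intro is_judgementI sat_maps_subset)
        ultimately have "derivable s B \<phi> (i, free (?C (Suc m)), sat_maps s B (?C (Suc m)))"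
          unfolding join_sat_maps[OF fr st, symmetric] fr by (rule derivable_join)
        then show ?thesis ..
      qed
    qed
  qed
  from this[of "length \<psi>s"] show ?case by simp
next
  case (Forall y \<psi>)
  have parent: "is_parent \<phi> i (i @ [0])" and loc: "i @ [0] \<in> locs \<phi>"
    and sub: "subformula \<phi> (i @ [0]) = \<psi>"
    using Forall.prems by (simp_all add: is_parent_snoc locs_snoc subformula_snoc)
  have "is_loc \<phi> i" using Forall.prems by (simp add: locs_def)
  from qc_over_subformula[OF assms(1) this] have ne: "universe B (s y) \<noteq> {}"
    using Forall.prems assms(2) by (simp add: structure_over_def)
  let ?J = "(i @ [0], free \<psi>, sat_maps s B \<psi>)"
  let ?K = "(i, free (Forall y \<psi>), sat_maps s B (Forall y \<psi>))"
  from Forall.IH[OF loc sub] show ?case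
  proof
    assume d: "derivable s B \<phi> ?J"
    have K: "is_judgement s B \<phi> ?K"
      using Forall.prems by (intro is_judgementI sat_maps_subset) auto
    have "derivable s B \<phi> ?K"
    proof (cases "y \<in> free \<psi>")
      case True
      have "subformula \<phi> i = Forall y (subformula \<phi> (i @ [0]))"
        using Forall.prems(2) sub by simp
      from derivable_forall_elimination[OF d True parent this] K
      show ?thesis by (simp add: forall_elim_sat_maps[OF True])
    next
      \<comment> \<open>The elimination rule does not apply, but over a nonempty universe the
        quantifier is vacuous and upward flow suffices.\<close>
      case False
      then have "sat s B \<psi> (f(y := b)) \<longleftrightarrow> sat s B \<psi> f" for f b
        by (intro sat_cong) auto
      then have "sat_maps s B (Forall y \<psi>) = sat_maps s B \<psi>"
        using False ne by (auto simp: sat_maps_def)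
      then show ?thesis using derivable_upward_flow[OF d parent] K False by simp
    qed
    then show ?thesis ..
  qed simp
next
  case (Exists y \<psi>)
  have parent: "is_parent \<phi> i (i @ [0])" and loc: "i @ [0] \<in> locs \<phi>"
    and sub: "subformula \<phi> (i @ [0]) = \<psi>"
    using Exists.prems by (simp_all add: is_parent_snoc locs_snoc subformula_snoc)
  have "is_loc \<phi> i" using Exists.prems by (simp add: locs_def)
  from qc_over_subformula[OF assms(1) this] have ne: "universe B (s y) \<noteq> {}"
    using Exists.prems assms(2) by (simp add: structure_over_def)
  let ?J = "(i @ [0], free \<psi>, sat_maps s B \<psi>)"
  \<comment> \<open>The variable \<open>y\<close> is projected away while still at the child: it is
    not free at \<open>i\<close>, so the unprojected triple might not be a judgement there.\<close>
  let ?K = "(i @ [0], free (Exists y \<psi>), sat_maps s B (Exists y \<psi>))"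
  let ?L = "(i, free (Exists y \<psi>), sat_maps s B (Exists y \<psi>))"
  from Exists.IH[OF loc sub] show ?case
  proof
    assume "free \<psi> = {} \<and> (\<forall>f. sat s B \<psi> f)"
    with ne show ?thesis by auto
  next
    assume d: "derivable s B \<phi> ?J"
    have eq: "proj (free (Exists y \<psi>)) (sat_maps s B \<psi>) = sat_maps s B (Exists y \<psi>)"
      using proj_sat_maps[of B s y \<psi>, OF ne] by simp
    have "is_judgement s B \<phi> ?K"
      using loc sub by (intro is_judgementI sat_maps_subset) auto
    then have K: "derivable s B \<phi> ?K"
      using derivable_projection[OF d, of "free (Exists y \<psi>)"] eq by auto
    have "is_judgement s B \<phi> ?L"
      using Exists.prems by (intro is_judgementI sat_maps_subset) auto
    from derivable_upward_flow[OF K parent this] show ?thesis ..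
  qed
qed

theorem theorem3p6:
  fixes \<Sigma> :: "('s, 'r) signature"
    and s :: "'v \<Rightarrow> 's"
    and \<phi> :: "('v, 'r) qc"
    and B :: "('s, 'r, 'b) struct"
  assumes "qcsp_instance \<Sigma> s \<phi> B"
  shows "(\<exists>J. empty_judgement J \<and> derivable s B \<phi> J) \<longleftrightarrow> \<not> models s B \<phi>"
proof
  have inst: "qc_over \<Sigma> s \<phi>" "structure_over \<Sigma> B" "free \<phi> = {}"
    using assms by (auto simp: qcsp_instance_def)
  show "\<not> models s B \<phi>" if "\<exists>J. empty_judgement J \<and> derivable s B \<phi> J"
  proof
    assume models: "models s B \<phi>"
    obtain i V where d: "derivable s B \<phi> (i, V, {})"
      using \<open>\<exists>J. _ J \<and> _ J\<close> by (auto simp: empty_judgement_def)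
    then have "i \<in> locs \<phi>"
      by (auto simp: derivable_def judgement_proof_def in_set_conv_nth is_judgement_def)
    then obtain f where "reached s B \<phi> i f"
      using reached_nonempty models inst by blast
    with derivable_reached[OF d models assms] show False by simp
  qed
  show "\<exists>J. empty_judgement J \<and> derivable s B \<phi> J" if "\<not> models s B \<phi>"
  proof -
    \<comment> \<open>Falsity under every assignment both empties \<open>sat_maps\<close> at the
      root and excludes the first alternative of \<open>derivable_sat_maps\<close>.\<close>
    have "\<not> sat s B \<phi> f" for f
      using that sat_cong[of \<phi> f "\<lambda>_. undefined" s B] inst(3) by (simp add: models_def)
    then have "sat_maps s B \<phi> = {}" "\<not> (\<forall>f. sat s B \<phi> f)" by (auto simp: sat_maps_def)
    then have "derivable s B \<phi> ([], free \<phi>, {})"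
      using derivable_sat_maps[OF inst(1,2), of "[]" \<phi>] by (auto simp: locs_def)
    then show ?thesis by (auto simp: empty_judgement_def)
  qed
qed

end
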